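(* Let $n,m,N\ge 1$ be integers, $A\in\mathbb R^{n\times n}$, $B\in\mathbb R^{n\times m}$, and let $Q_f,Q,W_f,W\in\mathbb S^n$, $R\in\mathbb S^m$ satisfy $Q_f\succeq 0$, $Q\succeq 0$, $R\succ 0$, $W_f\succ 0$, $W\succ 0$. Let $d_{\rm opt}$ be the optimal value of Dual problem I and $\tilde d_{\rm opt}$ the optimal value of Dual problem II, both defined in the context. Let $X_N=Q_f$ and, for $k=N-1,\dots,0$, $$X_k=A^TX_{k+1}A-A^TX_{k+1}B(R+B^TX_{k+1}B)^{-1}B^TX_{k+1}A+Q .$$ Then $d_{\rm opt}=\tilde d_{\rm opt}$, and $\{P_k\}_{k=0}^{N-1}$ with $$P_k=\begin{bmatrix}Q+A^TX_{k+1}A & A^TX_{k+1}B \\ B^TX_{k+1}A & R+B^TX_{k+1}B\end{bmatrix},\qquad k\in\{0,\dots,N-1\},$$ is an optimal point of Dual problem II.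
   Context: $\mathbb S^r$ denotes the real symmetric $r\times r$ matrices, $\mathbb S^r_+$ the positive semidefinite ones; $\succeq,\succ$ are the (strict) semidefinite orders. For $F\in\mathbb R^{m\times n}$ and $S,P\in\mathbb S^{n+m}$ put $$\Phi(F,S):=\begin{bmatrix} I_n \\ F\end{bmatrix}\left(\begin{bmatrix}A & B\end{bmatrix}S\begin{bmatrix}A & B\end{bmatrix}^T+W\right)\begin{bmatrix} I_n \\ F\end{bmatrix}^T ,$$ $$\Gamma(F,P):=\begin{bmatrix}A & B\end{bmatrix}^T\begin{bmatrix} I_n \\ F\end{bmatrix}^TP\begin{bmatrix} I_n \\ F\end{bmatrix}\begin{bmatrix}A & B\end{bmatrix}+\begin{bmatrix}Q&0 \\ 0&R\end{bmatrix},$$ and $$J_p(\{S_k\}_{k=0}^{N-1}):=\mathrm{Tr}\left(Q_f\left(\begin{bmatrix}A & B\end{bmatrix}S_{N-1}\begin{bmatrix}A & B\end{bmatrix}^T+W\right)\right)+\sum_{k=0}^{N-1}\mathrm{Tr}\left(\begin{bmatrix}Q&0 \\ 0&R\end{bmatrix}S_k\right).$$ Dual problem I. For $P_k,\bar P_k\in\mathbb S^{n+m}_+$ let $$L(\{(S_k,F_k,P_k,\bar P_k)\}_{k=0}^{N-1}):=J_p(\{S_k\})+\sum_{k=1}^{N-1}\mathrm{Tr}\big((\Phi(F_k,S_{k-1})-S_k)P_k\big)+\mathrm{Tr}\left(\left(\begin{bmatrix} I_n \\ F_0\end{bmatrix}W_f\begin{bmatrix} I_n \\ F_0\end{bmatrix}^T-S_0\right)P_0\right)-\sum_{k=0}^{N-1}\mathrm{Tr}(S_k\bar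 P_k),$$ $$d_{\rm opt}:=\sup_{P_k\succeq 0,\ \bar P_k\succeq 0\ (0\le k\le N-1)}\ \ \inf_{S_k\in\mathbb S^{n+m},\ F_k\in\mathbb R^{m\times n}\ (0\le k\le N-1)}L(\{(S_k,F_k,P_k,\bar P_k)\}_{k=0}^{N-1}),$$ where the inner infimum may be $-\infty$. Dual problem II. Write $P_k=\begin{bmatrix}P_{k,11}&P_{k,12} \\ P_{k,12}^T&P_{k,22}\end{bmatrix}$ with $P_{k,11}\in\mathbb S^n$, $P_{k,22}\in\mathbb S^m$, and set $P_N:=\begin{bmatrix}Q_f&0 \\ 0&0\end{bmatrix}$, $F_N:=0$. Then $\tilde d_{\rm opt}$ is the optimal value of maximizing $$J_d(\{P_k,F_k\}):=\mathrm{Tr}\left(\begin{bmatrix} I_n \\ F_0\end{bmatrix}W_f\begin{bmatrix} I_n \\ F_0\end{bmatrix}^TP_0\right)+\sum_{k=1}^{N}\mathrm{Tr}\left(\begin{bmatrix} I_n \\ F_k\end{bmatrix}W\begin{bmatrix} I_n \\ F_k\end{bmatrix}^TP_k\right)$$ over $P_0,\dots,P_{N-1}\in\mathbb S^{n+m}_+$ subject to $$\Gamma(F_k,P_k)\succeq P_{k-1}\ (k=1,\dots,N-1),\qquad \Gamma(0,P_N)\succeq P_{N-1},$$ $$P_{k,22}\succ 0,\qquad F_k=-P_{k,22}^{-1}P_{k,12}^T\quad (k=0,\dots,N-1).$$ *)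

theory Defs
  imports "HOL-Analysis.Analysis"
begin

text \<open>
  The dimensions \<open>n\<close> and \<open>m\<close> are the finite index types \<open>'n\<close> and \<open>'m\<close>, and a matrix with \<open>n + m\<close> rows
  or columns is indexed by \<open>'n + 'm\<close>. A family indexed by \<open>0, \<dots>, N - 1\<close> is a function on \<^typ>\<open>nat\<close>; its
  values outside the range occurring in a constraint or an objective are irrelevant.
\<close>

definition hcat :: "real^'a^'r \<Rightarrow> real^'b^'r \<Rightarrow> real^('a + 'b)^'r" where
  "hcat M1 M2 = (\<chi> i j. case j of Inl a \<Rightarrow> M1 $ i $ a | Inr b \<Rightarrow> M2 $ i $ b)"

definition vcat :: "real^'c^'a \<Rightarrow> real^'c^'b \<Rightarrow> real^'c^('a + 'b)" where
  "vcat M1 M2 = (\<chi> i. case i of Inl a \<Rightarrow> M1 $ a | Inr b \<Rightarrow> M2 $ b)"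

definition block_mat ::
  "real^'c^'a \<Rightarrow> real^'d^'a \<Rightarrow> real^'c^'b \<Rightarrow> real^'d^'b \<Rightarrow> real^('c + 'd)^('a + 'b)" where
  "block_mat M11 M12 M21 M22 = vcat (hcat M11 M12) (hcat M21 M22)"

definition block12 :: "real^('n + 'm)^('n + 'm) \<Rightarrow> real^'m^'n" where
  "block12 P = (\<chi> i j. P $ Inl i $ Inr j)"

definition block22 :: "real^('n::finite + 'm)^('n + 'm) \<Rightarrow> real^'m^'m" where
  "block22 P = (\<chi> i j. P $ Inr i $ Inr j)"

definition symmetric :: "real^'r^'r \<Rightarrow> bool" where
  "symmetric M \<longleftrightarrow> transpose M = M"

definition psd :: "real^'r^'r \<Rightarrow> bool" where
  "psd M \<longleftrightarrow> symmetric M \<and> (\<forall>x. 0 \<le> x \<bullet> (M *v x))"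

definition pd :: "real^'r^'r \<Rightarrow> bool" where
  "pd M \<longleftrightarrow> symmetric M \<and> (\<forall>x. x \<noteq> 0 \<longrightarrow> 0 < x \<bullet> (M *v x))"

definition loewner_ge :: "real^'r^'r \<Rightarrow> real^'r^'r \<Rightarrow> bool" where
  "loewner_ge M1 M2 \<longleftrightarrow> psd (M1 - M2)"

definition Phi ::
  "real^'n^'n \<Rightarrow> real^'m^'n \<Rightarrow> real^'n^'n \<Rightarrow> real^'n^'m \<Rightarrow> real^('n + 'm)^('n + 'm)
    \<Rightarrow> real^('n + 'm)^('n + 'm)" where
  "Phi A B W F S =
    vcat (mat 1) F ** (hcat A B ** S ** transpose (hcat A B) + W) ** transpose (vcat (mat 1) F)"

definition Gam ::
  "real^'n^'n \<Rightarrow> real^'m^'n \<Rightarrow> real^'n^'n \<Rightarrow> real^'m^'m \<Rightarrow> real^'n^'m \<Rightarrow> real^('n + 'm)^('n + 'm)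
    \<Rightarrow> real^('n + 'm)^('n + 'm)" where
  "Gam A B Q R F P =
    transpose (hcat A B) ** transpose (vcat (mat 1) F) ** P ** vcat (mat 1) F ** hcat A B
      + block_mat Q 0 0 R"

definition J_p ::
  "nat \<Rightarrow> real^'n^'n \<Rightarrow> real^'m^'n \<Rightarrow> real^'n^'n \<Rightarrow> real^'n^'n \<Rightarrow> real^'m^'m \<Rightarrow> real^'n^'n
    \<Rightarrow> (nat \<Rightarrow> real^('n + 'm)^('n + 'm)) \<Rightarrow> real" where
  "J_p N A B Qf Q R W S =
    trace (Qf ** (hcat A B ** S (N - 1) ** transpose (hcat A B) + W))
      + (\<Sum>k<N. trace (block_mat Q 0 0 R ** S k))"

definition Lagrangian ::
  "nat \<Rightarrow> real^'n^'n \<Rightarrow> real^'m^'n \<Rightarrow> real^'n^'n \<Rightarrow> real^'n^'n \<Rightarrow> real^'m^'m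
    \<Rightarrow> real^'n^'n \<Rightarrow> real^'n^'n
    \<Rightarrow> (nat \<Rightarrow> real^('n + 'm)^('n + 'm)) \<Rightarrow> (nat \<Rightarrow> real^'n^'m)
    \<Rightarrow> (nat \<Rightarrow> real^('n + 'm)^('n + 'm)) \<Rightarrow> (nat \<Rightarrow> real^('n + 'm)^('n + 'm)) \<Rightarrow> real" where
  "Lagrangian N A B Qf Q R Wf W S F P Pbar =
    J_p N A B Qf Q R W S
      + (\<Sum>k=1..N-1. trace ((Phi A B W (F k) (S (k - 1)) - S k) ** P k))
      + trace ((vcat (mat 1) (F 0) ** Wf ** transpose (vcat (mat 1) (F 0)) - S 0) ** P 0)
      - (\<Sum>k<N. trace (S k ** Pbar k))"

definition d_opt ::
  "nat \<Rightarrow> real^'n^'n \<Rightarrow> real^'m^'n \<Rightarrow> real^'n^'n \<Rightarrow> real^'n^'n \<Rightarrow> real^'m^'m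
    \<Rightarrow> real^'n^'n \<Rightarrow> real^'n^'n \<Rightarrow> ereal" where
  "d_opt N A B Qf Q R Wf W =
    (SUP (P, Pbar) \<in> {(P, Pbar). \<forall>k<N. psd (P k) \<and> psd (Pbar k)}.
      INF (S, F) \<in> {(S, F). \<forall>k<N. symmetric (S k)}.
        ereal (Lagrangian N A B Qf Q R Wf W S F P Pbar))"

text \<open>
  The decision variables of the second dual problem are \<open>P 0, \<dots>, P (N - 1)\<close>; the gains are determined
  by its equality constraint. The two functions below give both sequences, including the conventions
  at \<open>k = N\<close>.
\<close>

definition P_ext ::
  "nat \<Rightarrow> real^'n^'n \<Rightarrow> (nat \<Rightarrow> real^('n + 'm::finite)^('n + 'm))
    \<Rightarrow> nat \<Rightarrow> real^('n + 'm)^('n + 'm)" where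
  "P_ext N Qf P k = (if k = N then block_mat Qf 0 0 0 else P k)"

definition F_ext ::
  "nat \<Rightarrow> (nat \<Rightarrow> real^('n + 'm)^('n + 'm)) \<Rightarrow> nat \<Rightarrow> real^'n^'m" where
  "F_ext N P k =
    (if k = N then 0 else - (matrix_inv (block22 (P k)) ** transpose (block12 (P k))))"

definition J_d ::
  "nat \<Rightarrow> real^'n^'n \<Rightarrow> real^'n^'n
    \<Rightarrow> (nat \<Rightarrow> real^('n + 'm)^('n + 'm)) \<Rightarrow> (nat \<Rightarrow> real^'n^'m) \<Rightarrow> real" where
  "J_d N Wf W P F =
    trace (vcat (mat 1) (F 0) ** Wf ** transpose (vcat (mat 1) (F 0)) ** P 0)
      + (\<Sum>k=1..N. trace (vcat (mat 1) (F k) ** W ** transpose (vcat (mat 1) (F k)) ** P k))"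

definition dual2_objective ::
  "nat \<Rightarrow> real^'n^'n \<Rightarrow> real^'n^'n \<Rightarrow> real^'n^'n
    \<Rightarrow> (nat \<Rightarrow> real^('n + 'm::finite)^('n + 'm)) \<Rightarrow> real" where
  "dual2_objective N Qf Wf W P = J_d N Wf W (P_ext N Qf P) (F_ext N P)"

definition dual2_feasible ::
  "nat \<Rightarrow> real^'n^'n \<Rightarrow> real^'m^'n \<Rightarrow> real^'n^'n \<Rightarrow> real^'n^'n \<Rightarrow> real^'m^'m
    \<Rightarrow> (nat \<Rightarrow> real^('n + 'm)^('n + 'm)) \<Rightarrow> bool" where
  "dual2_feasible N A B Qf Q R P \<longleftrightarrow>
    (\<forall>k<N. psd (P k) \<and> pd (block22 (P k))) \<and>
    (\<forall>k\<in>{1..N-1}. loewner_ge (Gam A B Q R (F_ext N P k) (P k)) (P (k - 1))) \<and>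
    loewner_ge (Gam A B Q R 0 (P_ext N Qf P N)) (P (N - 1))"

definition dual2_opt ::
  "nat \<Rightarrow> real^'n^'n \<Rightarrow> real^'m^'n \<Rightarrow> real^'n^'n \<Rightarrow> real^'n^'n \<Rightarrow> real^'m^'m
    \<Rightarrow> real^'n^'n \<Rightarrow> real^'n^'n \<Rightarrow> ereal" where
  "dual2_opt N A B Qf Q R Wf W =
    (SUP P \<in> {P. dual2_feasible N A B Qf Q R P}. ereal (dual2_objective N Qf Wf W P))"

definition dual2_optimal_point ::
  "nat \<Rightarrow> real^'n^'n \<Rightarrow> real^'m^'n \<Rightarrow> real^'n^'n \<Rightarrow> real^'n^'n \<Rightarrow> real^'m^'m
    \<Rightarrow> real^'n^'n \<Rightarrow> real^'n^'n \<Rightarrow> (nat \<Rightarrow> real^('n + 'm)^('n + 'm)) \<Rightarrow> bool" where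
  "dual2_optimal_point N A B Qf Q R Wf W P \<longleftrightarrow>
    dual2_feasible N A B Qf Q R P \<and>
    (\<forall>P'. dual2_feasible N A B Qf Q R P' \<longrightarrow>
      dual2_objective N Qf Wf W P' \<le> dual2_objective N Qf Wf W P)"

end

theory Submission
  imports Defs
begin

text \<open>
  Both optimal values equal \<open>V = Tr(W\<^sub>f X\<^sub>0) + \<Sum>\<^bsub>k=1\<^esub>\<^bsup>N\<^esup> Tr(W X\<^sub>k)\<close>, because the Riccati recursion says that
  \<open>X\<^sub>k\<close> is the Schur complement of the given \<open>P\<^sub>k\<close>.

  For dual problem I, the multipliers \<open>diag(X\<^sub>k, 0)\<close> and \<open>P\<^sub>k - diag(X\<^sub>k, 0) \<succeq> 0\<close> make the Lagrangian
  constant, equal to \<open>V\<close>. The \<open>P\<^sub>k\<close> themselves would not do: for \<open>k \<ge> 1\<close> the term \<open>Tr(\<Phi>(F\<^sub>k, S) P\<^sub>k)\<close> is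
  unbounded below when the lower right block of \<open>P\<^sub>k\<close> is nonzero and \<open>[A B] \<noteq> 0\<close>, as \<open>S\<close> need only be symmetric.
  Conversely, the second moments generated by the optimal gains bound the inner infimum by \<open>V\<close>.

  For dual problem II, the Schur complement of \<open>P\<close> is the least value of \<open>[I; F]\<^sup>T P [I; F]\<close> over
  \<open>F\<close>, hence monotone in \<open>P\<close>. By downward induction every feasible point lies below the given one.
\<close>

section \<open>Symmetric and semidefinite matrices and the semidefinite order\<close>

lemma symmetric_nth: "symmetric M \<Longrightarrow> M $ i $ j = M $ j $ i"
  unfolding symmetric_def transpose_def by (metis vec_lambda_beta)

lemma inner_symmetric_mult:
  assumes "symmetric M"
  shows "x \<bullet> (M *v y) = (M *v x) \<bullet> y"
  using assms unfolding symmetric_def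
  by (metis dot_lmul_matrix transpose_matrix_vector)

lemma transpose_add: "transpose (M + N) = transpose M + transpose (N :: real^'a^'b)"
  by (simp add: transpose_def vec_eq_iff)

lemma transpose_diff: "transpose (M - N) = transpose M - transpose (N :: real^'a^'b)"
  by (simp add: transpose_def vec_eq_iff)

lemma matrix_add_rdistrib: "(M + N) ** K = M ** K + N ** (K :: real^'a^'b)"
  by (vector matrix_matrix_mult_def sum.distrib distrib_right)

lemma matrix_diff_rdistrib: "(M - N) ** K = M ** K - N ** (K :: real^'a^'b)"
  by (vector matrix_matrix_mult_def sum_subtractf left_diff_distrib)

lemma matrix_diff_ldistrib: "K ** (M - N) = K ** M - K ** (N :: real^'a^'b)"
  by (vector matrix_matrix_mult_def sum_subtractf right_diff_distrib)

lemma matrix_mult_uminus: "M ** (- N) = - (M ** (N :: real^'a^'b))"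
  by (simp add: matrix_matrix_mult_def vec_eq_iff sum_negf)

lemma psd_congruence:
  assumes "psd M"
  shows "psd (transpose C ** M ** C)"
proof -
  have "x \<bullet> ((transpose C ** M ** C) *v x) = (C *v x) \<bullet> (M *v (C *v x))" for x
    by (metis dot_lmul_matrix matrix_vector_mul_assoc transpose_matrix_vector
        transpose_transpose)
  moreover have "symmetric (transpose C ** M ** C)"
    using assms by (simp add: psd_def symmetric_def matrix_transpose_mul matrix_mul_assoc)
  ultimately show ?thesis
    using assms by (simp add: psd_def)
qed

lemma psd_add: "psd M \<Longrightarrow> psd N \<Longrightarrow> psd (M + N)"
  by (simp add: psd_def symmetric_def transpose_add inner_right_distrib
      matrix_vector_mult_add_rdistrib)

lemma psd_0: "psd 0"
  by (simp add: psd_def symmetric_def transpose_def vec_eq_iff)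

lemma pd_imp_psd: "pd M \<Longrightarrow> psd M"
  unfolding pd_def psd_def by (metis inner_zero_left less_eq_real_def)

lemma psd_imp_symmetric: "psd M \<Longrightarrow> symmetric M"
  by (simp add: psd_def)

lemma pd_add_psd: "pd M \<Longrightarrow> psd N \<Longrightarrow> pd (M + N)"
  by (simp add: pd_def psd_def symmetric_def transpose_add inner_right_distrib
      matrix_vector_mult_add_rdistrib add_pos_nonneg)

lemma loewner_ge_trans:
  "loewner_ge L M \<Longrightarrow> loewner_ge M N \<Longrightarrow> loewner_ge L N"
  unfolding loewner_ge_def using psd_add[of "L - M" "M - N"] by simp

lemma loewner_ge_refl: "loewner_ge M M"
  by (simp add: loewner_ge_def psd_0)

lemma loewner_ge_congruence:
  "loewner_ge M N \<Longrightarrow> loewner_ge (transpose C ** M ** C) (transpose C ** N ** C)"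
  unfolding loewner_ge_def using psd_congruence[of "M - N" C]
  by (simp add: matrix_diff_ldistrib matrix_diff_rdistrib)

lemma loewner_ge_add_right: "loewner_ge M N \<Longrightarrow> loewner_ge (M + K) (N + K)"
  by (simp add: loewner_ge_def)

lemma pd_mult_matrix_inv:
  fixes M :: "real^'a^'a"
  assumes "pd M"
  shows "M ** matrix_inv M = mat 1"
proof -
  have "\<And>x. M *v x = 0 \<Longrightarrow> x = 0"
    using assms unfolding pd_def by (metis inner_zero_right less_irrefl)
  then have "invertible M"
    unfolding invertible_left_inverse using matrix_left_invertible_ker by blast
  then show ?thesis
    unfolding invertible_def matrix_inv_def by (rule someI2_ex) simp
qed

section \<open>Cauchy-Schwarz for semidefinite forms and traces of products\<close>

lemma psd_row_Cauchy_Schwarz: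
  fixes M :: "real^'a^'a"
  assumes "psd M"
  shows "(M $ a \<bullet> x)\<^sup>2 \<le> M $ a $ a * (x \<bullet> (M *v x))"
proof -
  let ?b = "M $ a \<bullet> x" and ?c = "x \<bullet> (M *v x)"
  have sym: "symmetric M" using assms by (simp add: psd_def)
  have b: "axis a 1 \<bullet> (M *v x) = ?b"
    by (simp add: inner_axis' matrix_vector_mul_component)
  have b': "x \<bullet> (M *v axis a 1) = ?b"
    using b inner_symmetric_mult[OF sym] by (metis inner_commute)
  have d: "axis a 1 \<bullet> (M *v axis a 1) = M $ a $ a"
    by (simp add: inner_axis' inner_axis matrix_vector_mul_component)
  \<comment> \<open>The form is nonnegative on the line through \<open>x\<close> in the direction
    \<open>axis a 1\<close>; the claim is the discriminant condition for this quadratic in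
    \<open>t\<close>.\<close>
  have q: "0 \<le> ?c + 2 * t * ?b + t\<^sup>2 * M $ a $ a" for t
  proof -
    have "0 \<le> (x + t *\<^sub>R axis a 1) \<bullet> (M *v (x + t *\<^sub>R axis a 1))"
      using assms by (simp add: psd_def)
    also have "\<dots> = ?c + 2 * t * ?b + t\<^sup>2 * M $ a $ a"
      by (simp add: matrix_vector_right_distrib matrix_vector_mult_scaleR inner_simps b b' d
          power2_eq_square algebra_simps)
    finally show ?thesis .
  qed
  show ?thesis
  proof (cases "M $ a $ a = 0")
    case True
    have "?b = 0"
    proof (rule ccontr)
      assume "?b \<noteq> 0"
      \<comment> \<open>The chosen \<open>t\<close> gives the now affine expression the value
        -1.\<close>
      then show False
        using q[of "- (?c + 1) / (2 * ?b)"] True by (simp add: field_simps)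
    qed
    then show ?thesis using True by simp
  next
    case False
    have "0 \<le> M $ a $ a"
      using assms d by (metis psd_def)
    then have pos: "0 < M $ a $ a" using False by simp
    \<comment> \<open>The quadratic is evaluated at its minimiser.\<close>
    have "0 \<le> ?c - ?b\<^sup>2 / M $ a $ a"
      using q[of "- ?b / M $ a $ a"] False
      by (simp add: power2_eq_square field_simps)
    then show ?thesis
      using pos by (simp add: field_simps)
  qed
qed

lemma trace_mult_psd_nonneg:
  fixes M V :: "real^'a^'a"
  assumes "psd M" and "psd V"
  shows "0 \<le> trace (M ** V)"
proof -
  text \<open>Rank-one terms \<open>w w\<^sup>T\<close> are split off as in the Cholesky decomposition, by induction on the
    set of nonzero rows. Division by a zero pivot is harmless, since then the whole row vanishes.\<close>
  have "\<And>M. psd M \<Longrightarrow> (\<And>i. i \<notin> I \<Longrightarrow> M $ i = 0) \<Longrightarrow> 0 \<le> trace (M ** V)"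
    if "finite I" for I :: "'a set"
    using that
  proof (induction I rule: finite_induct)
    case empty
    then have "M = 0" by (simp add: vec_eq_iff)
    then show ?case by (simp add: trace_def)
  next
    case (insert a I)
    let ?w = "M $ a" and ?p = "M $ a $ a"
    define U :: "real^'a^'a" where "U = (\<chi> i j. ?w $ i * ?w $ j / ?p)"
    have sym: "symmetric M" using insert.prems by (simp add: psd_def)
    have U_mult: "U *v x = ((?w \<bullet> x) / ?p) *\<^sub>R ?w" for x
      by (simp add: U_def vec_eq_iff matrix_vector_mult_def inner_vec_def sum_distrib_left
          sum_divide_distrib sum_distrib_right mult_ac)
    have p: "0 \<le> ?p"
      using insert.prems(1) by (metis inner_axis' inner_axis inner_real_def matrix_vector_mul_component
          mult.left_neutral mult.right_neutral psd_def)
    have w0: "?w = 0" if "?p = 0"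
    proof -
      have "(?w \<bullet> ?w)\<^sup>2 \<le> 0"
        using psd_row_Cauchy_Schwarz[OF insert.prems(1), of a ?w] that by simp
      then show ?thesis by simp
    qed
    have "psd (M - U)"
    proof -
      have "symmetric U"
        by (simp add: U_def symmetric_def transpose_def vec_eq_iff mult_ac)
      then have "symmetric (M - U)"
        using sym by (simp add: symmetric_def transpose_diff)
      moreover have "0 \<le> x \<bullet> ((M - U) *v x)" for x
      proof -
        have "x \<bullet> ((M - U) *v x) = x \<bullet> (M *v x) - (?w \<bullet> x)\<^sup>2 / ?p"
          by (simp add: matrix_vector_mult_diff_rdistrib inner_diff_right U_mult inner_commute
              power2_eq_square)
        \<comment> \<open>Cauchy-Schwarz bounds the part split off, so the remainder stays
          semidefinite.\<close>
        moreover have "(?w \<bullet> x)\<^sup>2 / ?p \<le> x \<bullet> (M *v x)"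
        proof (cases "?p = 0")
          case True
          then show ?thesis using insert.prems(1) by (simp add: psd_def)
        next
          case False
          then show ?thesis
            using p psd_row_Cauchy_Schwarz[OF insert.prems(1), of a x]
            by (simp add: divide_le_eq mult.commute)
        qed
        ultimately show ?thesis by simp
      qed
      ultimately show ?thesis by (simp add: psd_def)
    qed
    \<comment> \<open>Row \<open>a\<close> of \<open>U\<close> is \<open>?w\<close> itself and gets
      cleared; a row that was already zero stays zero, since by symmetry the matching entry of
      \<open>?w\<close> vanishes.\<close>
    moreover have "(M - U) $ i = 0" if "i \<notin> I" for i
    proof (cases "i = a")
      case True
      then show ?thesis
        using w0 by (cases "?p = 0") (simp_all add: U_def vec_eq_iff)
    next
      case False
      then have "M $ i = 0" using insert.prems(2) that by simp
      moreover from this have "?w $ i = 0"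
        using symmetric_nth[OF sym, of a i] by simp
      ultimately show ?thesis by (simp add: U_def vec_eq_iff)
    qed
    ultimately have "0 \<le> trace ((M - U) ** V)" using insert.IH by blast
    moreover have "0 \<le> trace (U ** V)"
    proof -
      have "trace (U ** V) = ?w \<bullet> (V *v ?w) / ?p"
        by (subst trace_mul_sym)
          (simp add: trace_def matrix_matrix_mult_def matrix_vector_mult_def inner_vec_def U_def
            sum_distrib_left sum_divide_distrib mult_ac)
      then show ?thesis
        using p assms(2) by (simp add: psd_def)
    qed
    ultimately show ?case
      by (simp add: matrix_diff_rdistrib trace_sub)
  qed
  from this[OF finite[of UNIV]] show ?thesis using assms(1) by simp
qed

lemma trace_mult_mono:
  assumes "psd M" and "loewner_ge K L"
  shows "trace (M ** L) \<le> trace (M ** K)"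
  using trace_mult_psd_nonneg[OF assms(1), of "K - L"] assms(2)
  by (simp add: loewner_ge_def matrix_diff_ldistrib trace_sub)

text \<open>Cyclicity of the trace: congruence by \<open>transpose C\<close> is adjoint to
  congruence by \<open>C\<close>. This moves gains and dynamics from the moments to the
  multipliers.\<close>

lemma trace_mult_congruence:
  fixes C :: "real^'a^'b"
  shows "trace (C ** M ** transpose C ** K) = trace (M ** (transpose C ** K ** C))"
  by (metis matrix_mul_assoc trace_mul_sym)

section \<open>Block matrix calculus\<close>

lemma sum_UNIV_Plus:
  fixes f :: "'a::finite + 'b::finite \<Rightarrow> real"
  shows "sum f UNIV = (\<Sum>a\<in>UNIV. f (Inl a)) + (\<Sum>b\<in>UNIV. f (Inr b))"
  by (simp flip: UNIV_Plus_UNIV add: sum.Plus)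

lemma all_sum_iff: "(\<forall>i. p i) \<longleftrightarrow> (\<forall>a. p (Inl a)) \<and> (\<forall>b. p (Inr b))"
  by (metis sum.exhaust)

lemma hcat_mult_vcat: "hcat M1 M2 ** vcat N1 N2 = M1 ** N1 + M2 ** N2"
  by (simp add: hcat_def vcat_def matrix_matrix_mult_def vec_eq_iff sum_UNIV_Plus)

lemma mult_hcat: "K ** hcat M1 M2 = hcat (K ** M1) (K ** M2)"
  by (simp add: hcat_def matrix_matrix_mult_def vec_eq_iff all_sum_iff)

lemma vcat_mult: "vcat M1 M2 ** K = vcat (M1 ** K) (M2 ** K)"
  by (simp add: vcat_def matrix_matrix_mult_def vec_eq_iff all_sum_iff)

lemma transpose_hcat: "transpose (hcat M1 M2) = vcat (transpose M1) (transpose M2)"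
  by (simp add: hcat_def vcat_def transpose_def vec_eq_iff all_sum_iff)

lemma vcat_add: "vcat M1 M2 + vcat N1 N2 = vcat (M1 + N1) (M2 + N2)"
  by (simp add: vcat_def vec_eq_iff all_sum_iff)

lemma hcat_add: "hcat M1 M2 + hcat N1 N2 = hcat (M1 + N1) (M2 + N2)"
  by (simp add: hcat_def vec_eq_iff all_sum_iff)

lemma block_mat_mult_vcat:
  "block_mat M11 M12 M21 M22 ** vcat K1 K2
    = vcat (M11 ** K1 + M12 ** K2) (M21 ** K1 + M22 ** K2)"
  by (simp add: block_mat_def vcat_mult hcat_mult_vcat)

lemma transpose_0: "transpose 0 = (0 :: real^'a^'b)"
  by (simp add: transpose_def vec_eq_iff)

text \<open>Writing corner embeddings as congruences makes the facts on congruences apply to diag(M,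
  0) and diag(0, M).\<close>

lemma congruence_hcat_0:
  "transpose (hcat (mat 1) 0) ** M ** hcat (mat 1) 0 = block_mat M 0 0 0"
  "transpose (hcat 0 (mat 1)) ** M ** hcat 0 (mat 1) = block_mat 0 0 0 M"
  unfolding transpose_hcat mult_hcat vcat_mult block_mat_def
  by (simp_all add: transpose_0 hcat_def vcat_def vec_eq_iff all_sum_iff)

lemma psd_block_diag:
  fixes M :: "real^'a^'a" and K :: "real^'b^'b"
  assumes "psd M" and "psd K"
  shows "psd (block_mat M 0 0 K)"
proof -
  have "block_mat M 0 0 K = block_mat M 0 0 0 + block_mat 0 0 0 K"
    by (simp add: block_mat_def vcat_add hcat_add)
  then show ?thesis
    using assms by (simp add: psd_add psd_congruence flip: congruence_hcat_0)
qed

section \<open>Schur complements and the minimising gain\<close>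

definition block11 :: "real^('n + 'm::finite)^('n + 'm) \<Rightarrow> real^'n^'n" where
  "block11 P = (\<chi> i j. P $ Inl i $ Inl j)"

lemma block_mat_blocks:
  assumes "symmetric P"
  shows "block_mat (block11 P) (block12 P) (transpose (block12 P)) (block22 P) = P"
  using symmetric_nth[OF assms]
  by (simp add: block_mat_def hcat_def vcat_def block11_def block12_def block22_def transpose_def
      vec_eq_iff all_sum_iff)

lemma blocks_block_mat [simp]:
  "block11 (block_mat M11 M12 M21 M22) = M11"
  "block12 (block_mat M11 M12 M21 M22) = M12"
  "block22 (block_mat M11 M12 M21 M22) = M22"
  by (simp_all add: block_mat_def hcat_def vcat_def block11_def block12_def block22_def vec_eq_iff)

text \<open>For semidefinite \<open>P\<close> with positive definite lower right block, this
  \<open>F\<close> minimises \<open>transpose (lift F) ** P ** lift F\<close>.\<close>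

definition gain :: "real^('n::finite + 'm::finite)^('n + 'm) \<Rightarrow> real^'n^'m" where
  "gain P = - (matrix_inv (block22 P) ** transpose (block12 P))"

definition schur :: "real^('n::finite + 'm::finite)^('n + 'm) \<Rightarrow> real^'n^'n" where
  "schur P = block11 P - block12 P ** matrix_inv (block22 P) ** transpose (block12 P)"

abbreviation lift :: "real^'n::finite^'m::finite \<Rightarrow> real^'n^('n + 'm)" where
  "lift F \<equiv> vcat (mat 1) F"

text \<open>The projection onto the state; \<open>transpose proj ** M ** proj\<close> is diag(M,
  0).\<close>

abbreviation proj :: "real^('n::finite + 'm::finite)^'n" where
  "proj \<equiv> hcat (mat 1) 0"

lemma proj_lift: "proj ** lift F = mat 1"
  by (simp add: hcat_mult_vcat)

lemma lift_proj: "transpose (lift F) ** transpose proj = mat 1"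
  by (metis proj_lift matrix_transpose_mul transpose_mat)

lemma congruence_proj_lift:
  "transpose (lift F) ** (transpose proj ** M ** proj) ** lift F = M"
  by (metis lift_proj matrix_mul_assoc matrix_mul_lid matrix_mul_rid proj_lift)

text \<open>Block elimination: the gain is chosen to annihilate the lower block row, and the upper
  one becomes the Schur complement.\<close>

lemma mult_lift_gain:
  assumes "symmetric P" and "pd (block22 P)"
  shows "P ** lift (gain P) = transpose proj ** schur P"
proof -
  have "block22 P ** gain P = - transpose (block12 P)"
    by (simp add: gain_def matrix_mult_uminus matrix_mul_assoc pd_mult_matrix_inv[OF assms(2)])
  then have "block_mat (block11 P) (block12 P) (transpose (block12 P)) (block22 P)
      ** lift (gain P) = vcat (schur P) 0"
    by (simp add: block_mat_mult_vcat schur_def gain_def matrix_mult_uminus matrix_mul_assoc)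
  then show ?thesis
    by (simp add: block_mat_blocks[OF assms(1)] transpose_hcat vcat_mult transpose_0)
qed

text \<open>The lower block of \<open>P ** lift (gain P)\<close> is zero, so \<open>F\<close> has
  nothing to act on.\<close>

lemma lift_mult_lift_gain:
  assumes "symmetric P" and "pd (block22 P)"
  shows "transpose (lift F) ** P ** lift (gain P) = schur P"
proof -
  have "transpose (lift F) ** (P ** lift (gain P))
      = transpose (lift F) ** transpose proj ** schur P"
    by (simp add: mult_lift_gain[OF assms] matrix_mul_assoc)
  then show ?thesis
    by (simp add: lift_proj matrix_mul_assoc)
qed

lemma psd_schur: "psd P \<Longrightarrow> pd (block22 P) \<Longrightarrow> psd (schur P)"
  using psd_congruence[of P "lift (gain P)"]
  by (simp add: lift_mult_lift_gain psd_imp_symmetric)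

text \<open>The difference is the congruence of \<open>P\<close> by the projection \<open>1 - lift (gain P) ** proj\<close>.\<close>

lemma loewner_ge_schur:
  fixes P :: "real^('n::finite + 'm::finite)^('n + 'm)"
  assumes "psd P" and "pd (block22 P)"
  shows "loewner_ge P (transpose proj ** schur P ** proj)"
proof -
  let ?J = "proj :: real^('n + 'm)^'n"
  let ?E = "lift (gain P)"
  let ?C = "mat 1 - ?E ** ?J"
  have symP: "transpose P = P" and symS: "transpose (schur P) = schur P"
    using assms psd_schur by (auto simp: psd_def symmetric_def)
  have PE: "P ** ?E = transpose ?J ** schur P"
    using assms by (simp add: mult_lift_gain psd_def)
  have EP: "transpose ?E ** P = schur P ** ?J"
    by (metis PE matrix_transpose_mul symP symS transpose_transpose)
  have 1: "transpose ?J ** transpose ?E ** P = transpose ?J ** schur P ** ?J"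
    by (metis EP matrix_mul_assoc)
  have 2: "P ** (?E ** ?J) = transpose ?J ** schur P ** ?J"
    by (metis PE matrix_mul_assoc)
  have "transpose ?J ** schur P ** ?J ** (?E ** ?J) = transpose ?J ** schur P ** (?J ** ?E) ** ?J"
    by (simp only: matrix_mul_assoc)
  then have 3: "transpose ?J ** schur P ** ?J ** (?E ** ?J) = transpose ?J ** schur P ** ?J"
    by (simp only: proj_lift matrix_mul_rid)
  \<comment> \<open>Each of the three terms other than \<open>P\<close> equals Z =
    \<open>transpose ?J ** schur P ** ?J\<close>, and P - Z - Z + Z = P - Z.\<close>
  have "transpose ?C ** P ** ?C = P - transpose ?J ** schur P ** ?J"
    by (simp add: transpose_diff matrix_transpose_mul matrix_diff_ldistrib matrix_diff_rdistrib
        1 2 3)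
  then show ?thesis
    using psd_congruence[OF assms(1), of ?C] by (simp add: loewner_ge_def)
qed

text \<open>Congruence by \<open>lift F\<close> takes diag(schur P, 0) back to
  \<open>schur P\<close>, so the Schur complement is a lower bound for every
  \<open>F\<close>.\<close>

lemma loewner_ge_lift_schur:
  assumes "psd P" and "pd (block22 P)"
  shows "loewner_ge (transpose (lift F) ** P ** lift F) (schur P)"
  using loewner_ge_congruence[OF loewner_ge_schur[OF assms], of "lift F"]
  by (simp add: congruence_proj_lift)

text \<open>Both forms are compared at the gain of the larger matrix: it is optimal for
  \<open>P\<close> and merely admissible for \<open>P'\<close>.\<close>

lemma schur_mono:
  assumes "loewner_ge P P'" and "psd P" and "pd (block22 P)" and "psd P'" and "pd (block22 P')"
  shows "loewner_ge (schur P) (schur P')"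
proof -
  have "loewner_ge (schur P) (transpose (lift (gain P)) ** P' ** lift (gain P))"
    using loewner_ge_congruence[OF assms(1), of "lift (gain P)"] assms(2,3)
    by (simp add: lift_mult_lift_gain psd_def)
  then show ?thesis
    using loewner_ge_lift_schur[OF assms(4,5)] by (rule loewner_ge_trans)
qed

section \<open>\<open>Gam\<close> and \<open>Phi\<close> at minimising gains and at corner
  blocks\<close>

lemma Gam_gain:
  assumes "symmetric P" and "pd (block22 P)"
  shows "Gam A B Q R (gain P) P
    = transpose (hcat A B) ** schur P ** hcat A B + block_mat Q 0 0 R"
  unfolding Gam_def lift_mult_lift_gain[OF assms, of "gain P", symmetric]
  by (simp add: matrix_mul_assoc)

text \<open>Congruence by \<open>lift F\<close> recovers \<open>M\<close> from diag(M, 0) whatever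
  \<open>F\<close> is. This covers the terminal convention with diag(Qf, 0).\<close>

lemma Gam_proj:
  "Gam A B Q R F (transpose proj ** M ** proj)
    = transpose (hcat A B) ** M ** hcat A B + block_mat Q 0 0 R"
proof -
  have "Gam A B Q R F (transpose proj ** M ** proj)
      = transpose (hcat A B) ** (transpose (lift F) ** (transpose proj ** M ** proj) ** lift F)
          ** hcat A B + block_mat Q 0 0 R"
    by (simp add: Gam_def matrix_mul_assoc)
  then show ?thesis
    by (simp only: congruence_proj_lift)
qed

text \<open>Against a multiplier diag(M, 0) the gain drops out of \<open>Phi\<close>, so the
  Lagrangian loses its dependence on \<open>F\<close>.\<close>

lemma trace_Phi_proj:
  "trace (Phi A B W F S ** (transpose proj ** M ** proj))
    = trace (S ** (transpose (hcat A B) ** M ** hcat A B)) + trace (W ** M)"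
  unfolding Phi_def trace_mult_congruence congruence_proj_lift matrix_add_rdistrib trace_add ..

section \<open>The Riccati recursion\<close>

locale lqr =
  fixes N :: nat
    and A :: "real^'n^'n" and B :: "real^'m^'n"
    and Qf Q Wf W :: "real^'n^'n" and R :: "real^'m^'m"
    and X :: "nat \<Rightarrow> real^'n^'n"
    and P :: "nat \<Rightarrow> real^('n + 'm)^('n + 'm)"
  assumes N_ge_1: "1 \<le> N"
    and psd_Qf: "psd Qf" and psd_Q: "psd Q" and pd_R: "pd R" and pd_Wf: "pd Wf" and pd_W: "pd W"
    and X_N: "X N = Qf"
    and riccati: "\<And>k. k < N \<Longrightarrow> X k =
      transpose A ** X (k + 1) ** A
        - transpose A ** X (k + 1) ** B
          ** matrix_inv (R + transpose B ** X (k + 1) ** B)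
          ** transpose B ** X (k + 1) ** A
        + Q"
    and P_block: "\<And>k. k < N \<Longrightarrow> P k =
      block_mat (Q + transpose A ** X (k + 1) ** A) (transpose A ** X (k + 1) ** B)
        (transpose B ** X (k + 1) ** A) (R + transpose B ** X (k + 1) ** B)"
begin

abbreviation G :: "real^('n + 'm)^'n" where "G \<equiv> hcat A B"

abbreviation D :: "real^('n + 'm)^('n + 'm)" where "D \<equiv> block_mat Q 0 0 R"

lemma P_eq: "k < N \<Longrightarrow> P k = transpose G ** X (Suc k) ** G + D"
  unfolding P_block transpose_hcat mult_hcat vcat_mult block_mat_def
  by (simp add: hcat_def vcat_def vec_eq_iff all_sum_iff add.commute)

text \<open>Symmetry of \<open>X (Suc k)\<close> identifies the transposed upper right block of
  \<open>P k\<close> with its lower left one; the Schur complement is then the Riccati right-hand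
  side.\<close>

lemma X_eq_schur:
  assumes "k < N" and "symmetric (X (Suc k))"
  shows "X k = schur (P k)"
  using assms
  by (simp add: riccati P_block schur_def matrix_transpose_mul matrix_mul_assoc symmetric_def
      algebra_simps)

lemma psd_P_aux:
  assumes "k < N" and "psd (X (Suc k))"
  shows "psd (P k)" and "pd (block22 (P k))"
  using assms psd_congruence[of "X (Suc k)" B] psd_congruence[of "X (Suc k)" G]
  by (simp add: P_eq psd_add psd_block_diag psd_Q pd_imp_psd pd_R)
    (simp add: assms P_block pd_add_psd pd_R psd_congruence)

text \<open>Backward in \<open>k\<close>: semidefiniteness of \<open>X (Suc k)\<close> passes to
  \<open>P k\<close> and from there to its Schur complement \<open>X k\<close>.\<close>

lemma psd_X: "k \<le> N \<Longrightarrow> psd (X k)"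
proof (induction k rule: inc_induct)
  case base
  then show ?case by (simp add: X_N psd_Qf)
next
  case (step k)
  then show ?case
    using X_eq_schur[of k] psd_P_aux[of k] by (simp add: psd_schur psd_imp_symmetric)
qed

lemma psd_P: "k < N \<Longrightarrow> psd (P k)"
  and pd_P22: "k < N \<Longrightarrow> pd (block22 (P k))"
  and schur_P: "k < N \<Longrightarrow> schur (P k) = X k"
  using psd_X[of "Suc k"] psd_P_aux X_eq_schur by (simp_all add: psd_imp_symmetric)

section \<open>Dual problem II\<close>

definition opt_value :: real where
  "opt_value = trace (Wf ** X 0) + (\<Sum>k=1..N. trace (W ** X k))"

text \<open>After moving each gain onto its \<open>P' k\<close> by cyclicity, the congruence at the
  prescribed gain is the Schur complement; index \<open>N\<close> contributes
  \<open>Qf\<close>.\<close>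

lemma dual2_objective_eq:
  assumes "\<And>k. k < N \<Longrightarrow> psd (P' k)" and "\<And>k. k < N \<Longrightarrow> pd (block22 (P' k))"
  shows "dual2_objective N Qf Wf W P'
    = trace (Wf ** schur (P' 0))
      + (\<Sum>k=1..N. trace (W ** (if k = N then Qf else schur (P' k))))"
proof -
  let ?F = "F_ext N P'" and ?P = "P_ext N Qf P'"
  have "transpose (lift (?F k)) ** ?P k ** lift (?F k) = (if k = N then Qf else schur (P' k))"
    if "k \<le> N" for k
  proof (cases "k = N")
    case True
    then show ?thesis
      by (simp add: P_ext_def congruence_proj_lift flip: congruence_hcat_0)
  next
    case False
    then have "?F k = gain (P' k)" and "?P k = P' k"
      by (simp_all add: F_ext_def P_ext_def gain_def)
    then show ?thesis
      using assms[of k] that False by (simp add: lift_mult_lift_gain psd_imp_symmetric)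
  qed
  then show ?thesis
    using N_ge_1 by (simp add: dual2_objective_def J_d_def trace_mult_congruence)
qed

lemma dual2_objective_P: "dual2_objective N Qf Wf W P = opt_value"
  using N_ge_1
  by (subst dual2_objective_eq)
    (auto simp: psd_P pd_P22 schur_P opt_value_def X_N intro!: sum.cong)

text \<open>The order constraints all hold with equality, because \<open>P (k - 1)\<close> is built
  from \<open>X k\<close>, the Schur complement of \<open>P k\<close>.\<close>

lemma dual2_feasible_P: "dual2_feasible N A B Qf Q R P"
proof -
  have "Gam A B Q R (F_ext N P k) (P k) = P (k - 1)" if "k \<in> {1..N - 1}" for k
  proof -
    from that have k: "k < N" "k - 1 < N" "Suc (k - 1) = k" by auto
    then have "F_ext N P k = gain (P k)"
      by (simp add: F_ext_def gain_def)
    then show ?thesis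
      using k P_eq[of "k - 1"]
      by (simp add: Gam_gain psd_P pd_P22 schur_P psd_imp_symmetric)
  qed
  moreover have "Gam A B Q R 0 (P_ext N Qf P N) = P (N - 1)"
    using N_ge_1 P_eq[of "N - 1"]
    by (simp add: P_ext_def Gam_proj X_N flip: congruence_hcat_0)
  ultimately show ?thesis
    by (simp add: dual2_feasible_def psd_P pd_P22 loewner_ge_refl)
qed

lemma dual2_feasible_le_P:
  assumes feas: "dual2_feasible N A B Qf Q R P'" and "k < N"
  shows "loewner_ge (P k) (P' k)"
proof -
  have psd': "psd (P' j)" and pd': "pd (block22 (P' j))" if "j < N" for j
    using feas that by (auto simp: dual2_feasible_def)
  from \<open>k < N\<close> have "k \<le> N - 1" by simp
  then show ?thesis
  proof (induction k rule: inc_induct)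
    case base
    \<comment> \<open>The left side is \<open>P (N - 1)\<close> itself, as
      \<open>X N = Qf\<close>.\<close>
    have "loewner_ge (Gam A B Q R 0 (P_ext N Qf P' N)) (P' (N - 1))"
      using feas by (simp add: dual2_feasible_def)
    then show ?case
      using N_ge_1 P_eq[of "N - 1"]
      by (simp add: P_ext_def Gam_proj X_N flip: congruence_hcat_0)
  next
    case (step k)
    then have k: "Suc k < N" "Suc k \<in> {1..N - 1}" by auto
    \<comment> \<open>The Schur complement carries the bound at \<open>Suc k\<close> to an
      intermediate matrix below \<open>P k\<close>; the constraint with index \<open>Suc k\<close>
      puts that matrix above \<open>P' k\<close>.\<close>
    have "loewner_ge (X (Suc k)) (schur (P' (Suc k)))"
      using schur_mono[OF step.IH] k by (simp add: psd_P pd_P22 psd' pd' schur_P)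
    then have "loewner_ge (P k) (transpose G ** schur (P' (Suc k)) ** G + D)"
      using k by (simp add: P_eq loewner_ge_congruence loewner_ge_add_right)
    moreover have "F_ext N P' (Suc k) = gain (P' (Suc k))"
      using k by (simp add: F_ext_def gain_def)
    then have "loewner_ge (transpose G ** schur (P' (Suc k)) ** G + D) (P' k)"
      using feas k psd' pd'
      by (auto simp: dual2_feasible_def Gam_gain psd_imp_symmetric dest!: bspec[where x = "Suc k"])
    ultimately show ?case by (rule loewner_ge_trans)
  qed
qed

lemma dual2_objective_le:
  assumes feas: "dual2_feasible N A B Qf Q R P'"
  shows "dual2_objective N Qf Wf W P' \<le> opt_value"
proof -
  have psd': "psd (P' j)" and pd': "pd (block22 (P' j))" if "j < N" for j
    using feas that by (auto simp: dual2_feasible_def)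
  have le: "loewner_ge (X k) (schur (P' k))" if "k < N" for k
    using schur_mono[OF dual2_feasible_le_P[OF feas that]] that
    by (simp add: psd_P pd_P22 psd' pd' schur_P)
  have 0: "trace (Wf ** schur (P' 0)) \<le> trace (Wf ** X 0)"
    using N_ge_1 by (intro trace_mult_mono le pd_imp_psd pd_Wf) simp
  have k: "trace (W ** (if k = N then Qf else schur (P' k))) \<le> trace (W ** X k)"
    if "k \<in> {1..N}" for k
    using that le[of k] by (auto simp: X_N intro!: trace_mult_mono pd_imp_psd pd_W)
  have "dual2_objective N Qf Wf W P'
      = trace (Wf ** schur (P' 0))
        + (\<Sum>k=1..N. trace (W ** (if k = N then Qf else schur (P' k))))"
    by (rule dual2_objective_eq) (simp_all add: psd' pd')
  also have "\<dots> \<le> opt_value"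
    unfolding opt_value_def by (intro add_mono sum_mono 0 k)
  finally show ?thesis .
qed

section \<open>Dual problem I\<close>

text \<open>The coefficient of \<open>S k\<close> is
  \<open>transpose G ** X (Suc k) ** G + D\<close> minus the sum of its two multipliers, which is
  \<open>P k - P k = 0\<close>. Only the noise terms remain.\<close>

lemma Lagrangian_certificate:
  "Lagrangian N A B Qf Q R Wf W S F
    (\<lambda>k. transpose proj ** X k ** proj) (\<lambda>k. P k - transpose proj ** X k ** proj) = opt_value"
proof -
  obtain M where N: "N = Suc M" using N_ge_1 by (cases N) auto
  \<comment> \<open>The contributions of \<open>S k\<close> through the dynamics, the running cost
    and the multiplier diag(X k, 0). For the last index \<open>t\<close> comes from the terminal
    cost.\<close>
  define t where "t k = trace (S k ** (transpose G ** X (Suc k) ** G))" for k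
  define d where "d k = trace (S k ** D)" for k
  define e where "e k = trace (S k ** (transpose proj ** X k ** proj))" for k
  have "J_p N A B Qf Q R W S = t M + trace (W ** X N) + (\<Sum>k<N. d k)"
  proof -
    have "trace (Qf ** (G ** S M ** transpose G + W))
        = trace (G ** S M ** transpose G ** Qf) + trace (W ** Qf)"
      by (metis matrix_add_rdistrib trace_add trace_mul_sym)
    also have "trace (G ** S M ** transpose G ** Qf) = t M"
      by (simp add: trace_mult_congruence t_def X_N flip: N)
    finally show ?thesis
      by (simp add: J_p_def d_def N trace_mul_sym[of D] X_N[unfolded N])
  qed
  moreover have
    "trace ((Phi A B W (F (Suc k)) (S k) - S (Suc k)) ** (transpose proj ** X (Suc k) ** proj))
      = t k + trace (W ** X (Suc k)) - e (Suc k)" for k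
    by (simp add: matrix_diff_rdistrib trace_sub trace_Phi_proj t_def e_def)
  moreover have
    "trace ((lift (F 0) ** Wf ** transpose (lift (F 0)) - S 0) ** (transpose proj ** X 0 ** proj))
      = trace (Wf ** X 0) - e 0"
    by (simp add: matrix_diff_rdistrib trace_sub trace_mult_congruence congruence_proj_lift e_def)
  moreover have "(\<Sum>k<N. trace (S k ** (P k - transpose proj ** X k ** proj)))
      = (\<Sum>k<N. t k + d k - e k)"
    by (intro sum.cong)
      (simp_all add: P_eq matrix_diff_ldistrib matrix_add_ldistrib trace_sub trace_add t_def d_def
        e_def)
  \<comment> \<open>Matches the slack sum over \<open>0..M\<close> with the initial constraint plus
    the later ones.\<close>
  moreover have "(\<Sum>k<M. e k) + e M = e 0 + (\<Sum>k<M. e (Suc k))"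
    by (simp flip: sum.lessThan_Suc sum.lessThan_Suc_shift)
  ultimately show ?thesis
    unfolding Lagrangian_def opt_value_def
    by (simp add: N sum.atLeast1_atMost_eq sum.distrib sum_subtractf)
qed

text \<open>The primal optimum: the second moments of state and input under the optimal gains.\<close>

primrec S_opt :: "nat \<Rightarrow> real^('n + 'm)^('n + 'm)" where
  "S_opt 0 = lift (gain (P 0)) ** Wf ** transpose (lift (gain (P 0)))"
| "S_opt (Suc k) = Phi A B W (gain (P (Suc k))) (S_opt k)"

text \<open>Factoring through the graph of the optimal gain gives both semidefiniteness and
  complementary slackness; \<open>Y\<close> is the second moment of the state.\<close>

lemma S_opt_range:
  "\<exists>Y. psd Y \<and> S_opt k = lift (gain (P k)) ** Y ** transpose (lift (gain (P k)))"
proof (induction k)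
  case 0
  then show ?case using pd_Wf by (auto intro: pd_imp_psd)
next
  case (Suc k)
  then obtain Y where "psd Y"
    and "S_opt k = lift (gain (P k)) ** Y ** transpose (lift (gain (P k)))" by blast
  then have "psd (S_opt k)"
    using psd_congruence[of Y "transpose (lift (gain (P k)))"] by simp
  then have "psd (G ** S_opt k ** transpose G + W)"
    using psd_congruence[of "S_opt k" "transpose G"] pd_W by (simp add: psd_add pd_imp_psd)
  then show ?case by (auto simp: Phi_def)
qed

lemma psd_S_opt: "psd (S_opt k)"
  using S_opt_range[of k] psd_congruence[where C = "transpose (lift (gain (P k)))"] by auto

text \<open>On the graph of the gain both \<open>P k\<close> and diag(X k, 0) restrict to
  \<open>X k\<close>, so their difference vanishes there.\<close>

lemma S_opt_slackness:
  assumes "k < N"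
  shows "trace (S_opt k ** (P k - transpose proj ** X k ** proj)) = 0"
proof -
  have "transpose (lift (gain (P k))) ** (P k - transpose proj ** X k ** proj)
      ** lift (gain (P k)) = 0"
    using assms
    by (simp add: matrix_diff_ldistrib matrix_diff_rdistrib congruence_proj_lift
        lift_mult_lift_gain psd_P pd_P22 schur_P psd_imp_symmetric)
  moreover obtain Y where "S_opt k = lift (gain (P k)) ** Y ** transpose (lift (gain (P k)))"
    using S_opt_range by blast
  ultimately show ?thesis
    by (simp only: trace_mult_congruence) (simp add: trace_def)
qed

text \<open>All equality constraints hold at \<open>S_opt\<close>, which kills the terms in
  \<open>P'\<close> for every choice of \<open>P'\<close>.\<close>

lemma Lagrangian_S_opt:
  "Lagrangian N A B Qf Q R Wf W S_opt (\<lambda>k. gain (P k)) P' Pbar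
    = J_p N A B Qf Q R W S_opt - (\<Sum>k<N. trace (S_opt k ** Pbar k))"
proof -
  have "Phi A B W (gain (P k)) (S_opt (k - 1)) - S_opt k = 0" if "k \<in> {1..N - 1}" for k
    using that by (cases k) auto
  then show ?thesis
    by (simp add: Lagrangian_def trace_def)
qed

text \<open>At the certificate multipliers the Lagrangian is \<open>opt_value\<close>, while
  slackness reduces it to the primal cost; no second telescoping is needed.\<close>

lemma J_p_S_opt: "J_p N A B Qf Q R W S_opt = opt_value"
  using Lagrangian_certificate[of S_opt "\<lambda>k. gain (P k)"]
  by (simp add: Lagrangian_S_opt S_opt_slackness)

lemma d_opt_eq: "d_opt N A B Qf Q R Wf W = ereal opt_value"
proof (rule antisym)
  have "(INF (S, F) \<in> {(S, F). \<forall>k<N. symmetric (S k)}.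
      ereal (Lagrangian N A B Qf Q R Wf W S F P' Pbar)) \<le> ereal opt_value"
    if "\<forall>k<N. psd (P' k) \<and> psd (Pbar k)" for P' Pbar
  proof (rule INF_lower2)
    show "(S_opt, \<lambda>k. gain (P k)) \<in> {(S, F). \<forall>k<N. symmetric (S k)}"
      by (simp add: psd_S_opt psd_imp_symmetric)
    \<comment> \<open>Weak duality: at \<open>S_opt\<close> the multipliers \<open>Pbar\<close> can
      only lower the Lagrangian.\<close>
    have "0 \<le> (\<Sum>k<N. trace (S_opt k ** Pbar k))"
      using that by (intro sum_nonneg trace_mult_psd_nonneg psd_S_opt) simp
    then show "(case (S_opt, \<lambda>k. gain (P k)) of
        (S, F) \<Rightarrow> ereal (Lagrangian N A B Qf Q R Wf W S F P' Pbar)) \<le> ereal opt_value"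
      by (simp add: Lagrangian_S_opt J_p_S_opt)
  qed
  then show "d_opt N A B Qf Q R Wf W \<le> ereal opt_value"
    unfolding d_opt_def by (intro SUP_least) auto
next
  let ?P = "\<lambda>k. transpose proj ** X k ** proj"
  \<comment> \<open>Admissibility of the certificate; the second part says that \<open>P k\<close>
    dominates the corner embedding of its Schur complement.\<close>
  have "psd (?P k) \<and> psd (P k - ?P k)" if "k < N" for k
    using that loewner_ge_schur[of "P k"]
    by (simp add: psd_congruence psd_X psd_P pd_P22 schur_P loewner_ge_def)
  then show "ereal opt_value \<le> d_opt N A B Qf Q R Wf W"
    unfolding d_opt_def
    by (intro SUP_upper2[where i = "(?P, \<lambda>k. P k - ?P k)"])
      (auto simp: Lagrangian_certificate intro!: INF_greatest)
qed

lemma dual2_optimal_point_P: "dual2_optimal_point N A B Qf Q R Wf W P"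
  by (simp add: dual2_optimal_point_def dual2_feasible_P dual2_objective_P dual2_objective_le)

lemma dual2_opt_eq: "dual2_opt N A B Qf Q R Wf W = ereal opt_value"
  unfolding dual2_opt_def
proof (rule antisym)
  show "(SUP P' \<in> {P'. dual2_feasible N A B Qf Q R P'}.
      ereal (dual2_objective N Qf Wf W P')) \<le> ereal opt_value"
    by (rule SUP_least) (simp add: dual2_objective_le)
  show "ereal opt_value \<le> (SUP P' \<in> {P'. dual2_feasible N A B Qf Q R P'}.
      ereal (dual2_objective N Qf Wf W P'))"
    by (rule SUP_upper2[where i = P]) (simp_all add: dual2_feasible_P dual2_objective_P)
qed

end

theorem theorem3:
  fixes N :: nat
    and A :: "real^'n^'n" and B :: "real^'m^'n"
    and Qf Q Wf W :: "real^'n^'n" and R :: "real^'m^'m"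
    and X :: "nat \<Rightarrow> real^'n^'n"
    and P :: "nat \<Rightarrow> real^('n + 'm)^('n + 'm)"
  assumes "1 \<le> N"
    and "psd Qf" and "psd Q" and "pd R" and "pd Wf" and "pd W"
    and "X N = Qf"
    and "\<And>k. k < N \<Longrightarrow> X k =
      transpose A ** X (k + 1) ** A
        - transpose A ** X (k + 1) ** B
          ** matrix_inv (R + transpose B ** X (k + 1) ** B)
          ** transpose B ** X (k + 1) ** A
        + Q"
    and "\<And>k. k < N \<Longrightarrow> P k =
      block_mat (Q + transpose A ** X (k + 1) ** A) (transpose A ** X (k + 1) ** B)
        (transpose B ** X (k + 1) ** A) (R + transpose B ** X (k + 1) ** B)"
  shows "d_opt N A B Qf Q R Wf W = dual2_opt N A B Qf Q R Wf W
    \<and> dual2_optimal_point N A B Qf Q R Wf W P"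
proof -
  interpret lqr N A B Qf Q Wf W R X P
    by (rule lqr.intro) fact+
  show ?thesis
    by (simp add: d_opt_eq dual2_opt_eq dual2_optimal_point_P)
qed

end
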